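(* Let $A_2=\{231,321,4123,21534\}$. For every positive integer $n$ and every integer $k\ge 2$, the number of permutations in $\operatorname{Av}_n(A_2)$ with exactly $k$ inversions is $$\binom{n-k}{k}+\sum_{\ell=k-2}^{n-3}\binom{\ell-(k-2)}{k-2}=\binom{n-k}{k}+\binom{n-k}{k-1}=\binom{n-k+1}{k}.$$
   Context: $\operatorname{Av}_n(S)$ is the set of permutations of length $n$ avoiding every pattern in $S$ (classical pattern avoidance). An inversion of a permutation $\pi$ is a pair of positions $i<j$ with $\pi_i>\pi_j$. Binomial coefficients $\binom{a}{b}$ with integer arguments are taken to be $0$ unless $0\le b\le a$; empty sums are $0$. *)

theory Defs
  imports "HOL-Combinatorics.Multiset_Permutations"
begin

text \<open>
  Permutations are given in one-line notation, as lists of natural numbers; the permutations of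
  length \<open>n\<close> are the elements of \<^term>\<open>permutations_of_set {1..n}\<close>. List positions count from 0.
\<close>

definition order_isomorphic :: "nat list \<Rightarrow> nat list \<Rightarrow> bool" where
  "order_isomorphic xs ys \<longleftrightarrow>
     length xs = length ys \<and>
     (\<forall>i < length xs. \<forall>j < length xs. xs ! i < xs ! j \<longleftrightarrow> ys ! i < ys ! j)"

definition contains_pattern :: "nat list \<Rightarrow> nat list \<Rightarrow> bool" where
  "contains_pattern xs p \<longleftrightarrow>
     (\<exists>f :: nat \<Rightarrow> nat.
        strict_mono_on {..<length p} f \<and> f ` {..<length p} \<subseteq> {..<length xs} \<and>
        order_isomorphic (map (\<lambda>i. xs ! f i) [0..<length p]) p)"

definition Av :: "nat \<Rightarrow> nat list set \<Rightarrow> nat list set" where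
  "Av n S = {xs \<in> permutations_of_set {1..n}. \<forall>p \<in> S. \<not> contains_pattern xs p}"

definition inversions :: "nat list \<Rightarrow> (nat \<times> nat) set" where
  "inversions xs = {(i, j). i < j \<and> j < length xs \<and> xs ! i > xs ! j}"

definition A\<^sub>2 :: "nat list set" where
  "A\<^sub>2 = {[2, 3, 1], [3, 2, 1], [4, 1, 2, 3], [2, 1, 5, 3, 4]}"

text \<open>
  Binomial coefficients with integer arguments, equal to 0 unless \<open>0 \<le> b \<le> a\<close>. Neither
  \<^const>\<open>binomial\<close> with truncated subtraction nor \<^const>\<open>gbinomial\<close> follows this convention.
\<close>

definition int_binomial :: "int \<Rightarrow> int \<Rightarrow> nat" where
  "int_binomial a b = (if 0 \<le> b \<and> b \<le> a then nat a choose nat b else 0)"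

end

theory Submission
  imports Defs
begin

text \<open>
  Look at what follows the maximum \<open>n\<close> of a permutation avoiding the four patterns. By 321 it is
  increasing, by 4123 it has at most two entries, and by 231 it exceeds everything before \<open>n\<close>; if
  it has two entries, then by 21534 the part before \<open>n\<close> is increasing. So the permutation ends in
  \<open>n\<close>, in \<open>n, n - 1\<close>, or is \<open>1, \<dots>, n - 3, n, n - 2, n - 1\<close>, and the numbers \<open>a n k\<close> of such
  permutations with \<open>k\<close> inversions satisfy \<open>a n k = a (n - 1) k + a (n - 2) (k - 1) + [k = 2]\<close>
  for \<open>n \<ge> 3\<close> and \<open>k \<ge> 1\<close>. For \<open>k \<ge> 2\<close> this is Pascal's rule for \<open>(n - k + 1) choose k\<close>, where the
  extra term at \<open>k = 2\<close> makes up for \<open>a n 1 = n - 1\<close> instead of \<open>n choose 1\<close>.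
\<close>

section \<open>Pattern containment\<close>

text \<open>An occurrence becomes a list of indices instead of a function. For a pattern of explicit
  length, \<open>ex_length_Suc\<close> then splits the quantifier over the list into quantifiers
  over single indices.\<close>

lemma contains_pattern_iff_list:
  "contains_pattern xs p \<longleftrightarrow>
     (\<exists>is. length is = length p \<and> sorted_wrt (<) is \<and> set is \<subseteq> {..<length xs} \<and>
           order_isomorphic (map (\<lambda>i. xs ! i) is) p)" (is "_ \<longleftrightarrow> ?R")
proof
  assume "contains_pattern xs p"
  then obtain f where f: "strict_mono_on {..<length p} f" "f ` {..<length p} \<subseteq> {..<length xs}"
    "order_isomorphic (map (\<lambda>i. xs ! f i) [0..<length p]) p"
    unfolding contains_pattern_def by blast
  let ?is = "map f [0..<length p]"
  have "sorted_wrt (<) ?is"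
    using f(1) by (auto simp: sorted_wrt_iff_nth_less strict_mono_on_def)
  moreover have "set ?is \<subseteq> {..<length xs}" using f(2) by (auto simp: image_subset_iff)
  moreover have "order_isomorphic (map (\<lambda>i. xs ! i) ?is) p" using f(3) by (simp add: o_def)
  ultimately show ?R by (intro exI[of _ ?is]) simp
next
  assume ?R
  then obtain "is" where i: "length is = length p" "sorted_wrt (<) is" "set is \<subseteq> {..<length xs}"
    "order_isomorphic (map (\<lambda>i. xs ! i) is) p" by blast
  have "map (\<lambda>i. xs ! (is ! i)) [0..<length p] = map (\<lambda>i. xs ! i) is"
    using i(1) by (intro nth_equalityI) auto
  with i show "contains_pattern xs p"
    unfolding contains_pattern_def
    by (intro exI[of _ "\<lambda>j. is ! j"])
       (auto simp: strict_mono_on_def sorted_wrt_iff_nth_less subset_eq)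
qed

lemma contains_pattern_append:
  assumes "contains_pattern xs p"
  shows "contains_pattern (xs @ ys) p"
proof -
  from assms obtain "is" where i: "length is = length p" "sorted_wrt (<) is"
    "set is \<subseteq> {..<length xs}" "order_isomorphic (map (\<lambda>i. xs ! i) is) p"
    unfolding contains_pattern_iff_list by blast
  have "map (\<lambda>i. (xs @ ys) ! i) is = map (\<lambda>i. xs ! i) is"
    using i(3) by (auto simp: nth_append)
  with i have "order_isomorphic (map (\<lambda>i. (xs @ ys) ! i) is) p" by (simp only:)
  with i show ?thesis
    unfolding contains_pattern_iff_list by (intro exI[of _ "is"]) auto
qed

lemma ex_length_Suc:
  "(\<exists>xs. length xs = Suc n \<and> P xs) \<longleftrightarrow> (\<exists>x xs. length xs = n \<and> P (x # xs))"
  by (metis length_Suc_conv)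

text \<open>Comparing letters that are neighbours in value is enough, since transitivity gives the
  remaining comparisons, and likewise for positions. The three lemmas that follow work in the same
  way.\<close>

lemma contains_231_iff:
  "contains_pattern xs [2, 3, 1] \<longleftrightarrow>
     (\<exists>i j k. i < j \<and> j < k \<and> k < length xs \<and> xs ! k < xs ! i \<and> xs ! i < xs ! j)"
proof -
  have "order_isomorphic [a, b, c] [2, 3, 1] \<longleftrightarrow> c < a \<and> a < b" for a b c
    by (auto simp: order_isomorphic_def All_less_Suc)
  then show ?thesis
    unfolding contains_pattern_iff_list
    by (simp add: ex_length_Suc) (safe; meson less_trans)
qed

lemma contains_321_iff:
  "contains_pattern xs [3, 2, 1] \<longleftrightarrow>
     (\<exists>i j k. i < j \<and> j < k \<and> k < length xs \<and> xs ! k < xs ! j \<and> xs ! j < xs ! i)"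
proof -
  have "order_isomorphic [a, b, c] [3, 2, 1] \<longleftrightarrow> c < b \<and> b < a" for a b c
    by (auto simp: order_isomorphic_def All_less_Suc)
  then show ?thesis
    unfolding contains_pattern_iff_list
    by (simp add: ex_length_Suc) (safe; meson less_trans)
qed

lemma contains_4123_iff:
  "contains_pattern xs [4, 1, 2, 3] \<longleftrightarrow>
     (\<exists>i j k l. i < j \<and> j < k \<and> k < l \<and> l < length xs \<and>
        xs ! j < xs ! k \<and> xs ! k < xs ! l \<and> xs ! l < xs ! i)"
proof -
  have "order_isomorphic [a, b, c, d] [4, 1, 2, 3] \<longleftrightarrow> b < c \<and> c < d \<and> d < a" for a b c d
    by (auto simp: order_isomorphic_def All_less_Suc)
  then show ?thesis
    unfolding contains_pattern_iff_list
    by (simp add: ex_length_Suc) (safe; meson less_trans)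
qed

lemma contains_21534_iff:
  "contains_pattern xs [2, 1, 5, 3, 4] \<longleftrightarrow>
     (\<exists>i j k l m. i < j \<and> j < k \<and> k < l \<and> l < m \<and> m < length xs \<and>
        xs ! j < xs ! i \<and> xs ! i < xs ! l \<and> xs ! l < xs ! m \<and> xs ! m < xs ! k)"
proof -
  have "order_isomorphic [a, b, c, d, e] [2, 1, 5, 3, 4] \<longleftrightarrow> b < a \<and> a < d \<and> d < e \<and> e < c"
    for a b c d e
    by (auto simp: order_isomorphic_def All_less_Suc)
  then show ?thesis
    unfolding contains_pattern_iff_list
    by (simp add: ex_length_Suc) (safe; meson less_trans)
qed

section \<open>The structure of the avoiders\<close>

definition avoids :: "nat list \<Rightarrow> bool" where
  "avoids xs \<longleftrightarrow> (\<forall>p \<in> A\<^sub>2. \<not> contains_pattern xs p)"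

lemma avoids_appendD: "avoids (xs @ ys) \<Longrightarrow> avoids xs"
  unfolding avoids_def using contains_pattern_append by blast

text \<open>In 231 and in 321 two different letters exceed a later third one, and every such triple
  forms one of these two patterns. Premise 1 therefore covers both; it concludes an equality because
  the entries are not assumed distinct.\<close>

lemma avoidsI:
  assumes 1: "\<And>i j k. i < j \<Longrightarrow> j < k \<Longrightarrow> k < length xs \<Longrightarrow> xs ! k < xs ! i \<Longrightarrow> xs ! k < xs ! j \<Longrightarrow>
      xs ! i = xs ! j"
    and 2: "\<And>i j k l. i < j \<Longrightarrow> j < k \<Longrightarrow> k < l \<Longrightarrow> l < length xs \<Longrightarrow>
      xs ! j < xs ! k \<Longrightarrow> xs ! k < xs ! l \<Longrightarrow> xs ! l < xs ! i \<Longrightarrow> False"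
    and 3: "\<And>i j k l m. i < j \<Longrightarrow> j < k \<Longrightarrow> k < l \<Longrightarrow> l < m \<Longrightarrow> m < length xs \<Longrightarrow>
      xs ! j < xs ! i \<Longrightarrow> xs ! i < xs ! l \<Longrightarrow> xs ! l < xs ! m \<Longrightarrow> xs ! m < xs ! k \<Longrightarrow> False"
  shows "avoids xs"
proof -
  have "\<not> contains_pattern xs [2, 3, 1]"
    unfolding contains_231_iff using 1 by (metis less_trans less_irrefl)
  moreover have "\<not> contains_pattern xs [3, 2, 1]"
    unfolding contains_321_iff using 1 by (metis less_trans less_irrefl)
  moreover have "\<not> contains_pattern xs [4, 1, 2, 3]"
    unfolding contains_4123_iff by (intro notI; elim exE conjE; rule 2)
  moreover have "\<not> contains_pattern xs [2, 1, 5, 3, 4]"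
    unfolding contains_21534_iff by (intro notI; elim exE conjE; rule 3)
  ultimately show ?thesis by (simp add: avoids_def A\<^sub>2_def)
qed

lemma avoids_equal:
  assumes "avoids xs" "i < j" "j < k" "k < length xs" "xs ! k < xs ! i" "xs ! k < xs ! j"
  shows "xs ! i = xs ! j"
proof (rule ccontr)
  assume "xs ! i \<noteq> xs ! j"
  then consider "xs ! i < xs ! j" | "xs ! j < xs ! i" by linarith
  then have "contains_pattern xs [2, 3, 1] \<or> contains_pattern xs [3, 2, 1]"
  proof cases
    case 1
    with assms have "contains_pattern xs [2, 3, 1]" unfolding contains_231_iff by blast
    then show ?thesis ..
  next
    case 2
    with assms have "contains_pattern xs [3, 2, 1]" unfolding contains_321_iff by blast
    then show ?thesis ..
  qed
  with assms(1) show False by (auto simp: avoids_def A\<^sub>2_def)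
qed

lemma avoids_not_4123:
  assumes "avoids xs" "i < j" "j < k" "k < l" "l < length xs"
    "xs ! j < xs ! k" "xs ! k < xs ! l" "xs ! l < xs ! i"
  shows False
proof -
  have "contains_pattern xs [4, 1, 2, 3]"
    unfolding contains_4123_iff by (intro exI conjI) (rule assms)+
  with assms(1) show False by (simp add: avoids_def A\<^sub>2_def)
qed

lemma avoids_not_21534:
  assumes "avoids xs" "i < j" "j < k" "k < l" "l < m" "m < length xs"
    "xs ! j < xs ! i" "xs ! i < xs ! l" "xs ! l < xs ! m" "xs ! m < xs ! k"
  shows False
proof -
  have "contains_pattern xs [2, 1, 5, 3, 4]"
    unfolding contains_21534_iff by (intro exI conjI) (rule assms)+
  with assms(1) show False by (simp add: avoids_def A\<^sub>2_def)
qed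

section \<open>Extensions at the end that preserve avoidance\<close>

text \<open>The last letter of each forbidden pattern is smaller than an earlier letter, so the new
  maximum cannot end an occurrence.\<close>

lemma avoids_snoc_max:
  assumes ys: "avoids ys" and max: "\<forall>y \<in> set ys. y < m"
  shows "avoids (ys @ [m])"
proof -
  let ?zs = "ys @ [m]"
  have lt: "\<not> m < ys ! i" if "i < length ys" for i
    using that max by (simp add: less_imp_le leD)
  have old: "?zs ! i = ys ! i" if "i < length ys" for i
    using that by (simp add: nth_append)
  have last: "k < length ys" if "i < k" "k < length ?zs" "?zs ! k < ?zs ! i" for i k
    using that lt by (cases "k = length ys") (auto simp: nth_append)
  show ?thesis
  proof (rule avoidsI, goal_cases)
    case (1 i j k)
    then have "k < length ys" using last by (meson less_trans)
    with 1 have "i < length ys" "j < length ys" by auto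
    with 1 \<open>k < length ys\<close> show ?case using avoids_equal[OF ys, of i j k] by (simp add: old)
  next
    case (2 i j k l)
    then have "l < length ys" using last by (meson less_trans)
    with 2 have "i < length ys" "j < length ys" "k < length ys" by auto
    with 2 \<open>l < length ys\<close> show ?case
      using avoids_not_4123[OF ys, of i j k l] by (simp add: old)
  next
    case (3 i j k l m)
    then have "m < length ys" using last by (meson less_trans)
    with 3 have "i < length ys" "j < length ys" "k < length ys" "l < length ys" by auto
    with 3 \<open>m < length ys\<close> show ?case
      using avoids_not_21534[OF ys, of i j k l m] by (simp add: old)
  qed
qed

text \<open>The final \<open>m\<close> is smaller than its neighbour \<open>M\<close> only. In 231
  and 321 the last letter is smaller than two earlier ones, and in 4123 and 21534 it is smaller than
  a letter not adjacent to it. So no occurrence ends at \<open>m\<close>.\<close>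

lemma avoids_snoc_swap:
  assumes ys: "avoids ys" and max: "\<forall>y \<in> set ys. y < m" and "m < M"
  shows "avoids (ys @ [M, m])"
proof -
  let ?zs = "ys @ [M, m]"
  have lt: "\<not> m < ys ! i" if "i < length ys" for i
    using that max by (simp add: less_imp_le leD)
  have old: "?zs ! i = (ys @ [M]) ! i" if "i < Suc (length ys)" for i
    using that by (auto simp: nth_append)
  have ysM: "avoids (ys @ [M])"
    using ys max \<open>m < M\<close> by (intro avoids_snoc_max) auto
  have last: "k < Suc (length ys) \<or> k = Suc (length ys) \<and> i = length ys"
    if "i < k" "k < length ?zs" "?zs ! k < ?zs ! i" for i k
    using that lt \<open>m < M\<close>
    by (cases "k = Suc (length ys)"; cases "i = length ys") (auto simp: nth_append)
  show ?thesis
  proof (rule avoidsI, goal_cases)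
    case (1 i j k)
    then have "k < Suc (length ys)"
      using last[of i k] last[of j k] by auto
    with 1 have "i < Suc (length ys)" "j < Suc (length ys)" by auto
    with 1 \<open>k < Suc (length ys)\<close> show ?case
      using avoids_equal[OF ysM, of i j k] by (simp add: old)
  next
    case (2 i j k l)
    then have "l < Suc (length ys)" using last[of i l] by auto
    with 2 have "i < Suc (length ys)" "j < Suc (length ys)" "k < Suc (length ys)" by auto
    with 2 \<open>l < Suc (length ys)\<close> show ?case
      using avoids_not_4123[OF ysM, of i j k l] by (simp add: old)
  next
    case (3 i j k l m)
    then have "m < Suc (length ys)" using last[of k m] by auto
    with 3 have "i < Suc (length ys)" "j < Suc (length ys)" "k < Suc (length ys)" "l < Suc (length ys)"
      by auto
    with 3 \<open>m < Suc (length ys)\<close> show ?case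
      using avoids_not_21534[OF ysM, of i j k l m] by (simp add: old)
  qed
qed

text \<open>Used twice: to exclude the patterns and to count the inversions.\<close>

lemma inversion_snoc3_sorted:
  assumes "sorted xs" "\<forall>y \<in> set xs. y < a" "a < b" "b < (c :: nat)"
  shows "i < j \<and> j < length (xs @ [c, a, b]) \<and> (xs @ [c, a, b]) ! j < (xs @ [c, a, b]) ! i \<longleftrightarrow>
           i = length xs \<and> (j = length xs + 1 \<or> j = length xs + 2)"
proof -
  let ?l = "length xs" and ?zs = "xs @ [c, a, b]"
  have zs: "?zs ! ?l = c" "?zs ! (?l + 1) = a" "?zs ! (?l + 2) = b" "i < ?l \<Longrightarrow> ?zs ! i = xs ! i" for i
    by (auto simp: nth_append)
  show ?thesis
  proof (intro iffI)
    assume l: "i < j \<and> j < length ?zs \<and> ?zs ! j < ?zs ! i"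
    then have j: "j < ?l \<or> j = ?l \<or> j = ?l + 1 \<or> j = ?l + 2" by auto
    have "\<not> i < ?l"
    proof
      assume i: "i < ?l"
      then have "xs ! i < a" using assms(2) by simp
      moreover have "xs ! i \<le> xs ! j" if "j < ?l"
        using that l assms(1) by (simp add: sorted_nth_mono)
      ultimately show False using l j zs i assms(3,4) by (metis leD less_trans less_asym)
    qed
    moreover have "i \<noteq> ?l + 1"
    proof
      assume i: "i = ?l + 1"
      then have "j = ?l + 2" using l j by auto
      with i l zs assms(3) show False by simp
    qed
    ultimately show "i = ?l \<and> (j = ?l + 1 \<or> j = ?l + 2)" using l j by auto
  next
    assume "i = ?l \<and> (j = ?l + 1 \<or> j = ?l + 2)"
    then show "i < j \<and> j < length ?zs \<and> ?zs ! j < ?zs ! i"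
      using zs assms(3,4) by auto
  qed
qed

text \<open>All inversions start at \<open>c\<close> and reach at most two places to the right. But
  231, 321 and 21534 contain inversions with different starting points, and 4123 has one that spans
  three places.\<close>

lemma avoids_snoc3_sorted:
  assumes "sorted xs" "\<forall>y \<in> set xs. y < a" "a < b" "b < c"
  shows "avoids (xs @ [c, a, b])"
proof -
  note inv = inversion_snoc3_sorted[OF assms]
  show ?thesis
  proof (rule avoidsI, goal_cases)
    case (1 i j k)
    then show ?case using inv[of i k] inv[of j k] by auto
  next
    case (2 i j k l)
    then show ?case using inv[of i l] by auto
  next
    case (3 i j k l m)
    then show ?case using inv[of i j] inv[of k m] by auto
  qed
qed

section \<open>Decomposition at the maximum\<close>

lemma avoids_at_max_cases:
  assumes av: "avoids (us @ n # vs)" and dist: "distinct (us @ n # vs)"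
    and max: "\<forall>x \<in> set (us @ vs). x < n"
  obtains "vs = []"
  | v where "vs = [v]" "\<forall>u \<in> set us. u < v"
  | v w where "vs = [v, w]" "v < w" "\<forall>u \<in> set us. u < v" "sorted us"
proof -
  let ?xs = "us @ n # vs" and ?l = "length us"
  have nths: "?xs ! i = us ! i" if "i < ?l" for i using that by (simp add: nth_append)
  have nthl: "?xs ! ?l = n" by simp
  have nthv: "?xs ! (?l + Suc j) = vs ! j" for j
    by (metis add_Suc_right nth_append_length_plus nth_Cons_Suc add.commute plus_nat.simps(2))
  have vn: "vs ! j < n" if "j < length vs" for j using that max by simp
  \<comment> \<open>Otherwise \<open>us ! i\<close>, \<open>n\<close>, \<open>vs ! j\<close> form
    231.\<close>
  have below: "us ! i < vs ! j" if "i < ?l" "j < length vs" for i j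
  proof (rule ccontr)
    assume neg: "\<not> us ! i < vs ! j"
    have "us ! i \<in> set us" "vs ! j \<in> set vs" using that by auto
    with dist have "us ! i \<noteq> vs ! j" by auto
    with neg have "?xs ! (?l + Suc j) < ?xs ! i" using nths nthv that by simp
    moreover have "?xs ! (?l + Suc j) < ?xs ! ?l" using vn that nthv nthl by simp
    moreover have "?xs ! i \<noteq> ?xs ! ?l" using that nths nthl max by fastforce
    moreover have "?l < ?l + Suc j" "?l + Suc j < length ?xs" using that by auto
    ultimately show False using avoids_equal[OF av that(1)] by blast
  qed
  \<comment> \<open>Otherwise \<open>n\<close>, \<open>vs ! i\<close>, \<open>vs ! j\<close> form
    321.\<close>
  have incr: "vs ! i < vs ! j" if "i < j" "j < length vs" for i j
  proof (rule ccontr)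
    assume neg: "\<not> vs ! i < vs ! j"
    have "vs ! i \<noteq> vs ! j" using that dist by (simp add: nth_eq_iff_index_eq)
    with neg have "?xs ! (?l + Suc j) < ?xs ! (?l + Suc i)" using nthv by simp
    moreover have "?xs ! (?l + Suc j) < ?xs ! ?l" using vn that nthv nthl by simp
    moreover have "?xs ! (?l + Suc i) \<noteq> ?xs ! ?l" using that nthv nthl vn[of i] by simp
    moreover have "?l < ?l + Suc i" "?l + Suc i < ?l + Suc j" "?l + Suc j < length ?xs"
      using that by auto
    ultimately show False using avoids_equal[OF av] by metis
  qed
  \<comment> \<open>Otherwise \<open>n\<close> and the first three entries of \<open>vs\<close> form
    4123.\<close>
  have len: "length vs \<le> 2"
  proof (rule ccontr)
    assume "\<not> length vs \<le> 2"
    then have l: "2 < length vs" by simp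
    have "?xs ! (?l + Suc 0) < ?xs ! (?l + Suc 1)" "?xs ! (?l + Suc 1) < ?xs ! (?l + Suc 2)"
      "?xs ! (?l + Suc 2) < ?xs ! ?l"
      unfolding nthv nthl using l incr vn by auto
    moreover have "?l < ?l + Suc 0" "?l + Suc 0 < ?l + Suc 1" "?l + Suc 1 < ?l + Suc 2"
      "?l + Suc 2 < length ?xs" using l by auto
    ultimately show False using avoids_not_4123[OF av] by metis
  qed
  \<comment> \<open>An inversion of \<open>us\<close>, followed by \<open>n\<close> and the two
    entries of \<open>vs\<close>, would form 21534.\<close>
  have sorted: "sorted us" if l: "length vs = 2"
  proof (rule ccontr)
    assume "\<not> sorted us"
    then obtain i j where ij: "i < j" "j < ?l" "us ! j < us ! i"
      unfolding sorted_iff_nth_mono_less by (auto simp: not_le)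
    have "?xs ! j < ?xs ! i" "?xs ! i < ?xs ! (?l + Suc 0)"
      "?xs ! (?l + Suc 0) < ?xs ! (?l + Suc 1)" "?xs ! (?l + Suc 1) < ?xs ! ?l"
      unfolding nthv nthl using l ij incr vn below by (auto simp: nths)
    moreover have "?l < ?l + Suc 0" "?l + Suc 0 < ?l + Suc 1" "?l + Suc 1 < length ?xs"
      using l by auto
    ultimately show False using avoids_not_21534[OF av ij(1,2)] by metis
  qed
  consider "vs = []" | v where "vs = [v]" | v w where "vs = [v, w]"
    using len by (cases vs rule: list.exhaust; cases "tl vs"; cases "tl (tl vs)") auto
  then show thesis
  proof cases
    case 1
    then show ?thesis by (rule that(1))
  next
    case (2 v)
    moreover from 2 have "\<forall>u \<in> set us. u < v"
      using below[of _ 0] by (auto simp: in_set_conv_nth)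
    ultimately show ?thesis by (rule that(2))
  next
    case (3 v w)
    moreover from 3 have "v < w" using incr[of 0 1] by simp
    moreover from 3 have "\<forall>u \<in> set us. u < v"
      using below[of _ 0] by (auto simp: in_set_conv_nth)
    moreover from 3 have "sorted us" using sorted by simp
    ultimately show ?thesis by (rule that(3))
  qed
qed

section \<open>Recursion for the set of avoiders\<close>

lemma mem_Av_iff: "xs \<in> Av n A\<^sub>2 \<longleftrightarrow> distinct xs \<and> set xs = {1..n} \<and> avoids xs"
  by (auto simp: Av_def avoids_def permutations_of_set_def)

lemma finite_Av: "finite (Av n S)"
  unfolding Av_def by simp

lemma Av_0: "Av 0 A\<^sub>2 = {[]}"
  by (auto simp: mem_Av_iff intro!: avoidsI)

lemma Av_1: "Av (Suc 0) A\<^sub>2 = {[1]}"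
proof -
  have "xs = [1]" if "distinct xs" "set xs = {1 :: nat}" for xs
    using that by (cases xs; cases "tl xs") auto
  then show ?thesis by (auto simp: mem_Av_iff intro!: avoidsI)
qed

text \<open>The maximum here is \<open>n + 2\<close>. The third shape starts with
  \<open>1, ..., n - 1\<close> and uses the value \<open>n\<close> after the maximum, so it needs
  \<open>n \<ge> 1\<close>.\<close>

lemma Av_Suc_Suc:
  "Av (Suc (Suc n)) A\<^sub>2 =
     (\<lambda>ys. ys @ [n + 2]) ` Av (Suc n) A\<^sub>2 \<union> (\<lambda>ys. ys @ [n + 2, n + 1]) ` Av n A\<^sub>2 \<union>
     (if n = 0 then {} else {[1..<n] @ [n + 2, n, n + 1]})" (is "_ = ?A \<union> ?B \<union> ?C")
proof (intro equalityI subsetI)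
  fix xs assume "xs \<in> Av (Suc (Suc n)) A\<^sub>2"
  then have xs: "distinct xs" "set xs = {1..n + 2}" "avoids xs" by (auto simp: mem_Av_iff)
  then have "n + 2 \<in> set xs" by simp
  then obtain us vs where split: "xs = us @ (n + 2) # vs" by (meson split_list)
  have "set us \<union> set vs = set xs - {n + 2}"
    using xs(1) unfolding split by auto
  moreover have "{1..n + 2} - {n + 2} = {1..n + 1}" by auto
  ultimately have union: "set us \<union> set vs = {1..n + 1}" by (simp only: xs(2))
  have "\<forall>x \<in> set (us @ vs). x < n + 2" using union by fastforce
  from avoids_at_max_cases[OF xs(3)[unfolded split] xs(1)[unfolded split] this]
  show "xs \<in> ?A \<union> ?B \<union> ?C"
  proof cases
    case 1
    then have "us \<in> Av (Suc n) A\<^sub>2"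
      using xs split union by (auto simp: mem_Av_iff dest: avoids_appendD)
    with 1 split show ?thesis by auto
  next
    case (2 v)
    have eq: "insert v (set us) = {1..n + 1}" using 2 union by auto
    have "v \<in> {1..n + 1}" unfolding eq[symmetric] by simp
    moreover have "n + 1 \<in> insert v (set us)" unfolding eq by simp
    \<comment> \<open>The value \<open>n + 1\<close> occurs, and \<open>v\<close> exceeds every
      entry of \<open>us\<close>.\<close>
    ultimately have v: "v = n + 1" using 2(2) by fastforce
    have "v \<notin> set us" using 2(2) by auto
    then have "set us = insert v (set us) - {v}" by simp
    also have "\<dots> = {1..n}" by (subst eq) (auto simp: v)
    finally have "set us = {1..n}" .
    then have "us \<in> Av n A\<^sub>2"
      using xs split by (auto simp: mem_Av_iff dest: avoids_appendD)
    with 2 split v show ?thesis by auto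
  next
    case (3 v w)
    have eq: "insert v (insert w (set us)) = {1..n + 1}" using 3 union by auto
    have "w \<in> {1..n + 1}" "v \<in> {1..n + 1}" unfolding eq[symmetric] by simp_all
    moreover have "n + 1 \<in> insert v (insert w (set us))" unfolding eq by simp
    ultimately have w: "w = n + 1" using 3(2,3) by fastforce
    \<comment> \<open>This comes from \<open>1 \<le> v < w = n + 1\<close>.\<close>
    then have n: "n \<noteq> 0" using \<open>v \<in> _\<close> 3(2) by auto
    then have "n \<in> insert v (insert w (set us))" unfolding eq by simp
    then have v: "v = n" using 3(2,3) w by fastforce
    have "v \<notin> set us" "w \<notin> set us" using 3(2,3) by auto
    then have "set us = insert v (insert w (set us)) - {v, w}" by auto
    also have "\<dots> = set [1..<n]" by (subst eq) (auto simp: v w)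
    finally have "set us = set [1..<n]" .
    then have "us = [1..<n]"
      using 3(4) xs(1) split by (intro sorted_distinct_set_unique) auto
    with 3 split v w n show ?thesis by auto
  qed
next
  fix xs assume "xs \<in> ?A \<union> ?B \<union> ?C"
  then show "xs \<in> Av (Suc (Suc n)) A\<^sub>2"
  proof (elim UnE)
    assume "xs \<in> ?A"
    then show ?thesis by (auto simp: mem_Av_iff intro!: avoids_snoc_max)
  next
    assume "xs \<in> ?B"
    then show ?thesis by (auto simp: mem_Av_iff intro!: avoids_snoc_swap)
  next
    assume "xs \<in> ?C"
    then show ?thesis
      by (auto simp: mem_Av_iff intro!: avoids_snoc3_sorted split: if_splits)
  qed
qed

section \<open>Counting by inversions\<close>

lemma inversions_snoc_max:
  assumes "\<forall>y \<in> set ys. y < m"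
  shows "inversions (ys @ [m]) = inversions ys"
proof -
  have "\<not> m < ys ! i" if "i < length ys" for i
    using that assms by (simp add: less_imp_le leD)
  then show ?thesis by (auto simp: inversions_def nth_append less_Suc_eq)
qed

lemma inversions_snoc_swap:
  assumes "\<forall>y \<in> set ys. y < m" "m < M"
  shows "inversions (ys @ [M, m]) = insert (length ys, Suc (length ys)) (inversions ys)"
proof -
  have "\<not> m < ys ! i" "\<not> M < ys ! i" if "i < length ys" for i
  proof -
    have "ys ! i < m" using that assms(1) by simp
    with assms(2) show "\<not> m < ys ! i" "\<not> M < ys ! i" by simp_all
  qed
  then show ?thesis using assms(2) by (auto simp: inversions_def nth_append less_Suc_eq)
qed

lemma finite_inversions: "finite (inversions xs)"
  by (rule finite_subset[of _ "{..<length xs} \<times> {..<length xs}"]) (auto simp: inversions_def)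

lemma card_inversions_snoc_swap:
  assumes "\<forall>y \<in> set ys. y < m" "m < M"
  shows "card (inversions (ys @ [M, m])) = Suc (card (inversions ys))"
proof -
  have "(length ys, Suc (length ys)) \<notin> inversions ys" by (simp add: inversions_def)
  then show ?thesis by (simp add: inversions_snoc_swap[OF assms] finite_inversions)
qed

lemma card_inversions_snoc3_sorted:
  assumes "sorted xs" "\<forall>y \<in> set xs. y < a" "a < b" "b < c"
  shows "card (inversions (xs @ [c, a, b])) = 2"
proof -
  have "inversions (xs @ [c, a, b]) = {(length xs, length xs + 1), (length xs, length xs + 2)}"
    unfolding inversions_def using inversion_snoc3_sorted[OF assms] by auto
  then show ?thesis by simp
qed

section \<open>Recursion and closed form for the counts\<close>

definition num_Av_inv :: "nat \<Rightarrow> nat \<Rightarrow> nat" where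
  "num_Av_inv n k = card {xs \<in> Av n A\<^sub>2. card (inversions xs) = k}"

lemma num_Av_inv_0: "num_Av_inv 0 k = (if k = 0 then 1 else 0)"
proof -
  have inv: "inversions [] = {}" by (simp add: inversions_def)
  have "{xs \<in> Av 0 A\<^sub>2. card (inversions xs) = k} = (if k = 0 then {[]} else {})"
    by (auto simp: Av_0 inv)
  then show ?thesis by (simp add: num_Av_inv_def)
qed

lemma num_Av_inv_1: "num_Av_inv (Suc 0) k = (if k = 0 then 1 else 0)"
proof -
  have inv: "inversions [Suc 0] = {}" by (auto simp: inversions_def)
  have "{xs \<in> Av (Suc 0) A\<^sub>2. card (inversions xs) = k} = (if k = 0 then {[1]} else {})"
    by (auto simp: Av_1 inv)
  then show ?thesis by (simp add: num_Av_inv_def)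
qed

text \<open>Of the three shapes in \<open>Av_Suc_Suc\<close>, the first adds no inversion to the
  shorter permutation, the second adds one, and the third has exactly two.\<close>

lemma num_Av_inv_Suc_Suc:
  "num_Av_inv (Suc (Suc n)) k =
     num_Av_inv (Suc n) k + (if k = 0 then 0 else num_Av_inv n (k - 1)) +
     (if n \<noteq> 0 \<and> k = 2 then 1 else 0)"
proof -
  let ?A = "(\<lambda>ys. ys @ [n + 2]) ` {xs \<in> Av (Suc n) A\<^sub>2. card (inversions xs) = k}"
  \<comment> \<open>With \<open>Suc\<close> on the left the set is empty for \<open>k = 0\<close>,
    which a condition with the truncated \<open>k - 1\<close> would not ensure.\<close>
  let ?B = "(\<lambda>ys. ys @ [n + 2, n + 1]) ` {xs \<in> Av n A\<^sub>2. Suc (card (inversions xs)) = k}"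
  let ?C = "if n \<noteq> 0 \<and> k = 2 then {[1..<n] @ [n + 2, n, n + 1]} else {}"
  have A: "card (inversions (ys @ [n + 2])) = card (inversions ys)" if "ys \<in> Av (Suc n) A\<^sub>2" for ys
    using that by (subst inversions_snoc_max) (auto simp: mem_Av_iff)
  have B: "card (inversions (ys @ [n + 2, n + 1])) = Suc (card (inversions ys))"
    if "ys \<in> Av n A\<^sub>2" for ys
    using that by (subst card_inversions_snoc_swap) (auto simp: mem_Av_iff)
  have C: "card (inversions ([1..<n] @ [n + 2, n, n + 1])) = 2"
    by (rule card_inversions_snoc3_sorted) auto
  have fin: "finite ?A" "finite ?B" "finite ?C"
    by (simp_all add: finite_Av)
  have split: "{xs \<in> Av (Suc (Suc n)) A\<^sub>2. card (inversions xs) = k} = (?A \<union> ?B) \<union> ?C"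
  proof -
    have sep: "{xs \<in> f ` S \<union> g ` T \<union> U. P xs} =
        f ` {x \<in> S. P (f x)} \<union> g ` {x \<in> T. P (g x)} \<union> {x \<in> U. P x}"
      for f g :: "nat list \<Rightarrow> nat list" and S T U P by auto
    have "{xs \<in> Av (Suc n) A\<^sub>2. card (inversions (xs @ [n + 2])) = k} =
        {xs \<in> Av (Suc n) A\<^sub>2. card (inversions xs) = k}"
      by (intro Collect_cong conj_cong refl) (simp only: A)
    moreover have "{xs \<in> Av n A\<^sub>2. card (inversions (xs @ [n + 2, n + 1])) = k} =
        {xs \<in> Av n A\<^sub>2. Suc (card (inversions xs)) = k}"
      by (intro Collect_cong conj_cong refl) (simp only: B)
    moreover have "{xs \<in> (if n = 0 then {} else {[1..<n] @ [n + 2, n, n + 1]}).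
        card (inversions xs) = k} = ?C"
      using C by (cases "n = 0") auto
    ultimately show ?thesis unfolding Av_Suc_Suc sep by (simp only:)
  qed
  \<comment> \<open>Disjointness is visible at the end of the lists: \<open>?A\<close> ends in
    \<open>n + 2\<close>, \<open>?B\<close> in \<open>n + 2, n + 1\<close>, and \<open>?C\<close> in
    \<open>n, n + 1\<close>.\<close>
  have cC: "card ((?A \<union> ?B) \<union> ?C) = card (?A \<union> ?B) + card ?C"
    by (intro card_Un_disjoint finite_UnI fin) auto
  have cAB: "card (?A \<union> ?B) = card ?A + card ?B"
    by (intro card_Un_disjoint fin) auto
  have cA: "card ?A = num_Av_inv (Suc n) k"
    unfolding num_Av_inv_def by (intro card_image) (auto simp: inj_on_def)
  have cB: "card ?B = card {xs \<in> Av n A\<^sub>2. Suc (card (inversions xs)) = k}"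
    by (intro card_image) (auto simp: inj_on_def)
  have cB': "card {xs \<in> Av n A\<^sub>2. Suc (card (inversions xs)) = k} = (if k = 0 then 0 else num_Av_inv n (k - 1))"
    by (cases k) (auto simp: num_Av_inv_def)
  have "card ?C = (if n \<noteq> 0 \<and> k = 2 then 1 else 0)" by simp
  then show ?thesis
    unfolding num_Av_inv_def[of "Suc (Suc n)"] split cC cAB cA cB cB' by (simp only:)
qed

text \<open>
  The closed form \<open>(n + 1 - k) choose k\<close> fails at \<open>k = 1\<close>: the only avoiders with one inversion
  are the \<open>n - 1\<close> adjacent transpositions.
\<close>

lemma num_Av_inv_eq:
  "num_Av_inv n k = (if k = 1 then n - 1 else (n + 1 - k) choose k)"
proof (induction n arbitrary: k rule: induct_nat_012)
  case 0
  then show ?case by (cases k) (auto simp: num_Av_inv_0)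
next
  case 1
  then show ?case by (cases k) (auto simp: num_Av_inv_1 binomial_eq_0)
next
  case (ge2 n)
  note rec = num_Av_inv_Suc_Suc[of n k, unfolded ge2.IH]
  \<comment> \<open>The bound \<open>m \<le> n + 1\<close> lets Pascal's rule apply without
    truncation; for \<open>k > n + 2\<close> all the binomials are 0.\<close>
  consider "k = 0" | "k = 1" | "k = 2" | m where "k = Suc m" "m \<ge> 2" "m \<le> n + 1"
    | "k \<ge> 3" "k > n + 2"
    by (cases k) (auto, linarith)
  then show ?case
  proof cases
    case 3
    \<comment> \<open>For \<open>n > 0\<close> the extra 1 turns \<open>n - 1\<close> into
      \<open>n choose 1\<close>; for \<open>n = 0\<close> there is no extra term and the truncated
      \<open>n - 1\<close> is already 0.\<close>
    show ?thesis
      using 3 rec by (cases n) (auto simp: numeral_2_eq_2)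
  next
    case (4 m)
    with rec show ?thesis by (simp add: Suc_diff_le)
  qed (use rec in auto)
qed

section \<open>The binomial identities\<close>

lemma int_binomial_of_nat: "int_binomial (int a) (int b) = a choose b"
  by (auto simp: int_binomial_def binomial_eq_0)

lemma int_binomial_neg: "a < 0 \<Longrightarrow> int_binomial a b = 0"
  by (simp add: int_binomial_def)

text \<open>This is the hockey-stick identity after the shift \<open>j = l - (k - 2)\<close>. For
  \<open>n \<le> k\<close> the range of summation is empty, and the right-hand side is 0 because
  \<open>k \<ge> 2\<close>.\<close>

lemma sum_int_binomial:
  assumes "k \<ge> 2"
  shows "(\<Sum>l = int k - 2..int n - 3. int_binomial (l - (int k - 2)) (int k - 2))
           = int_binomial (int n - int k) (int k - 1)"
proof -
  define r where "r = k - 2"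
  have r: "int k - 2 = int r" "int k - 1 = int (Suc r)" using assms by (auto simp: r_def)
  show ?thesis
  proof (cases "n > k")
    case True
    \<comment> \<open>\<open>d\<close> is the largest value of the shifted index, as
      \<open>n - 3 = (k - 2) + d\<close>.\<close>
    define d where "d = n - k - 1"
    have d: "int n - int k = int (Suc d)" "int n - 3 = int (r + d)"
      using True assms by (auto simp: d_def r_def)
    have "(\<Sum>l = int r..int (r + d). int_binomial (l - int r) (int r)) =
          (\<Sum>j = 0..d. j choose r)"
      by (rule sum.reindex_bij_witness[of _ "\<lambda>j. int (r + j)" "\<lambda>l. nat (l - int r)"])
         (auto simp flip: int_binomial_of_nat)
    also have "\<dots> = Suc d choose Suc r"
      by (simp add: sum_choose_upper atLeast0AtMost)
    finally show ?thesis unfolding r d int_binomial_of_nat .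
  next
    case False
    then show ?thesis using assms by (auto simp: int_binomial_def)
  qed
qed

text \<open>For \<open>k > n\<close> both upper arguments on the left are negative and the one on
  the right is at most \<open>0 < k\<close>, so everything vanishes. Otherwise this is the rule for
  natural numbers.\<close>

lemma int_binomial_Pascal:
  assumes "k \<ge> 1"
  shows "int_binomial (int n - int k) (int k) + int_binomial (int n - int k) (int k - 1)
           = int_binomial (int n - int k + 1) (int k)"
proof (cases "k \<le> n")
  case True
  obtain r where k: "k = Suc r" using assms by (cases k) auto
  have eqs: "int n - int k = int (n - k)" "int n - int k + 1 = int (Suc (n - k))"
    "int k - 1 = int r" using True k by auto
  show ?thesis unfolding eqs(2,3) unfolding eqs(1) int_binomial_of_nat by (simp add: k)
next
  case False
  then show ?thesis using assms by (auto simp: int_binomial_def)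
qed

theorem theorem3p3:
  fixes n k :: nat
  assumes "n \<ge> 1" and "k \<ge> 2"
  shows "card {xs \<in> Av n A\<^sub>2. card (inversions xs) = k}
           = int_binomial (int n - int k) (int k)
             + (\<Sum>l = int k - 2..int n - 3. int_binomial (l - (int k - 2)) (int k - 2))
       \<and> int_binomial (int n - int k) (int k)
             + (\<Sum>l = int k - 2..int n - 3. int_binomial (l - (int k - 2)) (int k - 2))
           = int_binomial (int n - int k) (int k) + int_binomial (int n - int k) (int k - 1)
       \<and> int_binomial (int n - int k) (int k) + int_binomial (int n - int k) (int k - 1)
           = int_binomial (int n - int k + 1) (int k)"
proof -
  \<comment> \<open>Truncation changes the upper argument only for \<open>k > n + 1\<close>, where
    both sides are 0.\<close>
  have "(n + 1 - k) choose k = int_binomial (int n - int k + 1) (int k)"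
  proof (cases "k \<le> n + 1")
    case True
    then have "int n - int k + 1 = int (n + 1 - k)" by auto
    then show ?thesis by (simp only: int_binomial_of_nat)
  next
    case False
    then show ?thesis using assms(2) by (simp add: int_binomial_neg)
  qed
  then have "card {xs \<in> Av n A\<^sub>2. card (inversions xs) = k} =
      int_binomial (int n - int k + 1) (int k)"
    using num_Av_inv_eq[of n k] assms(2) by (simp add: num_Av_inv_def)
  then show ?thesis
    using sum_int_binomial[OF assms(2), of n] int_binomial_Pascal[of k n] assms(2) by simp
qed

end
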